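(* Let $\lambda$ be a self-conjugate partition and $\mu$ a doubled distinct partition, let $\Delta$ be the set of principal hook lengths of $\lambda$ together with those of $\mu$, and let $\nu$ be the doubled distinct partition whose set of principal hook lengths is $2\Delta=\{2h:h\in\Delta\}$. Then $|\lambda|+|\mu|=|\nu|/2$, $\delta_\lambda\delta_\mu=\delta_\nu$, and for every complex number $t$, \[ \prod_{h \in \Delta} \left(1-\frac{2t+2}{h}\right)\left(1-\frac{t+1}{h}\right) \prod_{j=1}^{h-1}\left( 1-\left(\frac{2t+2}{h +\tau_j j} \right)^2 \right)= \prod_{h \in \mathcal{H}(\nu)} \left(1-\frac{2t+2}{h \, \varepsilon_h}\right), \] where $\tau_j=1$ if $j\in\Delta$ and $\tau_j=-1$ otherwise.
   Context: A partition $\lambda=(\lambda_1\ge\dots\ge\lambda_\ell>0)$ has weight $|\lambda|=\sum\lambda_i$, conjugate $\lambda'$, boxes $(i,j)$ with $1\le j\le\lambda_i$, and hook lengths $h(i,j)=\lambda_i-j+\lambda'_j-i+1$; $\mathcal{H}(\lambda)$ is the multiset of hook lengths. Its principal hook lengths are $h(i,i)$ for the indices $i$ with $\lambda_i\ge i$; the number of such $i$ is $D(\lambda)$, and $\delta_\lambda=(-1)^{D(\lambda)}$. For $h\in\mathcal H(\nu)$ coming from the box $(i,j)$, $\varepsilon_h=-1$ if $j<i$ and $\varepsilon_h=1$ otherwise. Self-conjugate: $\lambda=\lambda'$. A doubled distinct partition is either empty or, for integers $a_1>\dots>a_d\ge1$, the partition with $D(\lambda)=d$ and $\lambda_i-i=a_i$,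 $\lambda'_i-i=a_i-1$ for $i\le d$; its principal hook lengths are $2a_1>\dots>2a_d$, so it is determined by its set of principal hook lengths. *)

theory Defs
  imports Complex_Main
begin

text \<open>
  A partition is the list of its parts in weakly decreasing order, all of them positive.
  Rows, columns and boxes are indexed from 1, and a part beyond the length counts as 0.
\<close>

definition is_partition :: "nat list \<Rightarrow> bool" where
  "is_partition p \<longleftrightarrow> sorted_wrt (\<ge>) p \<and> (\<forall>x\<in>set p. 0 < x)"

definition weight :: "nat list \<Rightarrow> nat" where
  "weight p = sum_list p"

definition part :: "nat list \<Rightarrow> nat \<Rightarrow> nat" where
  "part p i = (if 1 \<le> i \<and> i \<le> length p then p ! (i - 1) else 0)"

definition conjugate :: "nat list \<Rightarrow> nat list" where
  "conjugate p = map (\<lambda>j. card {i. 1 \<le> i \<and> i \<le> length p \<and> j \<le> part p i}) [1..<part p 1 + 1]"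

definition boxes :: "nat list \<Rightarrow> (nat \<times> nat) set" where
  "boxes p = {(i, j). 1 \<le> i \<and> i \<le> length p \<and> 1 \<le> j \<and> j \<le> part p i}"

text \<open>Only meant for boxes \<open>(i, j)\<close> of \<open>p\<close>, where neither subtraction truncates.\<close>

definition hook :: "nat list \<Rightarrow> nat \<Rightarrow> nat \<Rightarrow> nat" where
  "hook p i j = (part p i - j) + (part (conjugate p) j - i) + 1"

definition diag :: "nat list \<Rightarrow> nat set" where
  "diag p = {i. 1 \<le> i \<and> i \<le> length p \<and> i \<le> part p i}"

definition principal_hooks :: "nat list \<Rightarrow> nat set" where
  "principal_hooks p = (\<lambda>i. hook p i i) ` diag p"

definition durfee :: "nat list \<Rightarrow> nat" where
  "durfee p = card (diag p)"

definition delta :: "nat list \<Rightarrow> int" where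
  "delta p = (- 1) ^ durfee p"

text \<open>The sign \<open>\<epsilon>\<close> of a hook length belongs to the box \<open>(i, j)\<close> it comes from, not to its value.\<close>

definition box_sign :: "nat \<Rightarrow> nat \<Rightarrow> complex" where
  "box_sign i j = (if j < i then - 1 else 1)"

definition self_conjugate :: "nat list \<Rightarrow> bool" where
  "self_conjugate p \<longleftrightarrow> is_partition p \<and> conjugate p = p"

definition doubled_distinct :: "nat list \<Rightarrow> bool" where
  "doubled_distinct p \<longleftrightarrow> is_partition p \<and>
     (p = [] \<or>
      (\<exists>a :: nat \<Rightarrow> nat.
         (\<forall>i\<in>{1..durfee p}. 1 \<le> a i) \<and>
         (\<forall>i\<in>{1..durfee p}. \<forall>k\<in>{1..durfee p}. i < k \<longrightarrow> a k < a i) \<and>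
         (\<forall>i\<in>{1..durfee p}.
            int (part p i) - int i = int (a i) \<and>
            int (part (conjugate p) i) - int i = int (a i) - 1)))"

definition tau :: "nat set \<Rightarrow> nat \<Rightarrow> complex" where
  "tau S j = (if j \<in> S then 1 else - 1)"

end

theory Submission
  imports Defs
begin

text \<open>
  Let \<open>a\<^sub>1 > \<dots> > a\<^sub>d\<close> be the elements of \<open>S\<close>, so that the \<open>i\<close>-th principal hook of \<open>\<nu>\<close>
  has length \<open>2 a\<^sub>i\<close>. Group the boxes of \<open>\<nu>\<close> by principal hooks and fix \<open>i\<close>. The boxes
  \<open>(i, k)\<close> and \<open>(k, i)\<close> with \<open>i < k \<le> d\<close> have hook length \<open>a\<^sub>i + a\<^sub>k\<close> and opposite signs;
  they give the factors \<open>j = a\<^sub>k \<in> S\<close>. The hook lengths right of the Durfee square in row \<open>i\<close>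
  are the \<open>a\<^sub>i - j\<close> with \<open>0 \<le> j < a\<^sub>i\<close>, \<open>j \<notin> S\<close>, and those below it in column \<open>i\<close> are
  the same ones except \<open>j = 0\<close>: they are distinct, avoid the \<open>a\<^sub>i - a\<^sub>k\<close>, and have the right
  number. This gives the factors \<open>j \<notin> S\<close>, and \<open>j = 0\<close> and the diagonal box give the
  two linear ones. The weights and signs follow because a partition is the disjoint union of its
  principal hooks, whose lengths are odd for \<open>\<lambda>\<close> and even for \<open>\<mu>\<close>.
\<close>

section \<open>Parts and conjugate parts\<close>

lemma down_closed_eq_atLeastAtMost:
  fixes A :: "nat set"
  assumes "finite A" and pos: "\<And>i. i \<in> A \<Longrightarrow> 1 \<le> i"
    and down: "\<And>i j. j \<in> A \<Longrightarrow> 1 \<le> i \<Longrightarrow> i \<le> j \<Longrightarrow> i \<in> A"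
  shows "A = {1..card A}"
proof (cases "A = {}")
  case False
  have "A = {1..Max A}"
  proof
    show "A \<subseteq> {1..Max A}" using \<open>finite A\<close> pos by auto
    show "{1..Max A} \<subseteq> A" using down Max_in[OF \<open>finite A\<close> False] by auto
  qed
  then show ?thesis by (metis card_atLeastAtMost diff_Suc_1 One_nat_def)
qed simp

lemma part_antimono:
  assumes "is_partition p" "1 \<le> i" "i \<le> j"
  shows "part p j \<le> part p i"
proof (cases "i < j \<and> j \<le> length p")
  case True
  then have "p ! (j - 1) \<le> p ! (i - 1)"
    using assms sorted_wrt_nth_less[of "(\<ge>)" p "i - 1" "j - 1"]
    by (auto simp: is_partition_def)
  then show ?thesis using True assms by (auto simp: part_def)
next
  case False
  then show ?thesis using assms by (cases "i = j") (auto simp: part_def)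
qed

text \<open>Both sides say that \<open>(i, j)\<close> is a box: the rows that reach column
  \<open>j\<close> form an initial segment, so their number is the index of the last one.\<close>

lemma le_part_conjugate_iff:
  assumes "is_partition p" "1 \<le> i" "1 \<le> j"
  shows "i \<le> part (conjugate p) j \<longleftrightarrow> j \<le> part p i"
proof -
  define A where "A = {i. 1 \<le> i \<and> i \<le> length p \<and> j \<le> part p i}"
  have "A = {1..card A}"
  proof (rule down_closed_eq_atLeastAtMost)
    show "finite A" unfolding A_def by (rule finite_subset[of _ "{..length p}"]) auto
    show "i \<in> A" if "k \<in> A" "1 \<le> i" "i \<le> k" for i k
      using that part_antimono[OF assms(1) that(2,3)] unfolding A_def by auto
  qed (auto simp: A_def)
  moreover have "part (conjugate p) j = card A"
  \<comment> \<open>The list \<open>conjugate p\<close> has length \<open>part p 1\<close>; for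
    larger \<open>j\<close> the default value 0 of \<open>part\<close> agrees with \<open>A\<close>
    being empty.\<close>
  proof (cases "j \<le> part p 1")
    case True
    then have "j - 1 < length [1..<part p 1 + 1]" and "[1..<part p 1 + 1] ! (j - 1) = j"
      using \<open>1 \<le> j\<close> nth_upt[of 1 "j - 1" "part p 1 + 1"] by (simp_all del: upt_Suc)
    then show ?thesis using \<open>1 \<le> j\<close>
      unfolding part_def[of "conjugate p"] unfolding conjugate_def length_map A_def
      by (simp only: nth_map) (simp del: upt_Suc)
  next
    case False
    have "A = {}"
      using order_trans[OF _ part_antimono[OF assms(1) le_refl]] False unfolding A_def by blast
    then show ?thesis using False
      unfolding part_def[of "conjugate p"] by (simp add: conjugate_def)
  qed
  moreover have "i \<in> A \<longleftrightarrow> j \<le> part p i"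
    using assms(2,3) by (auto simp: A_def part_def split: if_splits)
  ultimately show ?thesis using \<open>1 \<le> i\<close> by (metis atLeastAtMost_iff)
qed

text \<open>The row of the lowest box in column \<open>j\<close> reaches column \<open>j\<close>,
  hence also column \<open>i\<close>.\<close>

lemma part_conjugate_antimono:
  assumes "is_partition p" "1 \<le> i" "i \<le> j"
  shows "part (conjugate p) j \<le> part (conjugate p) i"
proof (cases "part (conjugate p) j = 0")
  case False
  then have "j \<le> part p (part (conjugate p) j)"
    using assms le_part_conjugate_iff[OF assms(1), of "part (conjugate p) j" j] by simp
  then show ?thesis
    using False assms le_part_conjugate_iff[OF assms(1), of "part (conjugate p) j" i] by simp
qed simp

section \<open>The Durfee square and principal hooks\<close>

lemma boxes_eq: "boxes p = {(i, j). 1 \<le> i \<and> 1 \<le> j \<and> j \<le> part p i}"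
  by (auto simp: boxes_def part_def split: if_splits)

lemma diag_eq:
  assumes "is_partition p"
  shows "diag p = {1..durfee p}"
  unfolding durfee_def
proof (rule down_closed_eq_atLeastAtMost)
  show "finite (diag p)" unfolding diag_def by (rule finite_subset[of _ "{..length p}"]) auto
  show "i \<in> diag p" if "k \<in> diag p" "1 \<le> i" "i \<le> k" for i k
    using that part_antimono[OF assms that(2,3)] unfolding diag_def by auto
qed (auto simp: diag_def)

lemma le_part_self_iff:
  assumes "is_partition p" "1 \<le> i"
  shows "i \<le> part p i \<longleftrightarrow> i \<le> durfee p"
proof -
  have "i \<in> diag p \<longleftrightarrow> i \<le> part p i"
    using assms by (auto simp: diag_def part_def split: if_splits)
  then show ?thesis using diag_eq[OF assms(1)] assms(2) by auto
qed

lemma le_part_conjugate_self_iff: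
  assumes "is_partition p" "1 \<le> i"
  shows "i \<le> part (conjugate p) i \<longleftrightarrow> i \<le> durfee p"
  using assms by (simp add: le_part_conjugate_iff le_part_self_iff)

text \<open>The boxes are grouped by \<open>min i j\<close>.\<close>

lemma (in comm_monoid_set) boxes_by_principal_hooks:
  assumes "is_partition p"
  shows "F g (boxes p) = F (\<lambda>i. F (\<lambda>j. g (i, j)) {i..part p i} \<^bold>*
           F (\<lambda>r. g (r, i)) {i<..part (conjugate p) i}) {1..durfee p}"
proof -
  \<comment> \<open>The arm contains the corner \<open>(i, i)\<close> and the leg starts one row
    lower, so the corner is counted once.\<close>
  define H where "H i = Pair i ` {i..part p i} \<union> (\<lambda>r. (r, i)) ` {i<..part (conjugate p) i}" for i
  have H: "(r, c) \<in> H i \<longleftrightarrow> (r, c) \<in> boxes p \<and> min r c = i" if "1 \<le> i" for r c i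
  proof (cases "1 \<le> r \<and> 1 \<le> c")
    case True
    then show ?thesis using le_part_conjugate_iff[OF assms, of r c]
      by (auto simp: H_def boxes_eq min_def)
  next
    case False
    then show ?thesis using that by (auto simp: H_def boxes_eq)
  qed
  have "boxes p = (\<Union>i\<in>{1..durfee p}. H i)"
  proof (intro set_eqI iffI)
    fix x assume x: "x \<in> boxes p"
    obtain r c where rc: "x = (r, c)" by (cases x)
    define i where "i = min r c"
    have "1 \<le> i" and "i \<le> c" and "i \<le> r" "c \<le> part p r"
      using x by (auto simp: rc i_def boxes_eq)
    \<comment> \<open>Here \<open>i \<le> c \<le> part p r \<le> part p i\<close>, so
      \<open>(i, i)\<close> is a box as well.\<close>
    moreover have "i \<le> durfee p"
      using part_antimono[OF assms, of i r] calculation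
      by (simp add: le_part_self_iff[OF assms, symmetric])
    ultimately show "x \<in> (\<Union>i\<in>{1..durfee p}. H i)"
      using H[of i r c] x i_def rc by auto
  next
    fix x assume "x \<in> (\<Union>i\<in>{1..durfee p}. H i)"
    then show "x \<in> boxes p" using H by (cases x) auto
  qed
  then have "F g (boxes p) = F (\<lambda>i. F g (H i)) {1..durfee p}"
  proof (simp only:, intro UNION_disjoint ballI impI)
    show "H i \<inter> H j = {}" if "i \<in> {1..durfee p}" "j \<in> {1..durfee p}" "i \<noteq> j" for i j
      using that H[of i] H[of j] by fastforce
  qed (auto simp: H_def)
  also have "\<dots> = F (\<lambda>i. F (\<lambda>j. g (i, j)) {i..part p i} \<^bold>*
           F (\<lambda>r. g (r, i)) {i<..part (conjugate p) i}) {1..durfee p}"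
  proof (rule cong[OF refl])
    fix i
    have "F g (H i) = F g (Pair i ` {i..part p i}) \<^bold>*
        F g ((\<lambda>r. (r, i)) ` {i<..part (conjugate p) i})"
      unfolding H_def by (rule union_disjoint) auto
    then show "F g (H i) = F (\<lambda>j. g (i, j)) {i..part p i} \<^bold>*
           F (\<lambda>r. g (r, i)) {i<..part (conjugate p) i}"
      by (simp add: reindex inj_on_def comp_def)
  qed
  finally show ?thesis .
qed

lemma weight_eq_card_boxes: "weight p = card (boxes p)"
proof -
  have "boxes p = Sigma {1..length p} (\<lambda>i. {1..part p i})"
    by (auto simp: boxes_def)
  then have "card (boxes p) = (\<Sum>i = 1..length p. part p i)" by simp
  also have "\<dots> = (\<Sum>i<length p. p ! i)"
    by (rule sum.reindex_bij_witness[of _ Suc "\<lambda>i. i - 1"]) (auto simp: part_def)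
  finally show ?thesis by (simp add: weight_def sum_list_sum_nth atLeast0LessThan)
qed

text \<open>Going down the diagonal, row and column lengths weakly decrease while the corner moves
  on, so the hook lengths strictly decrease. Hence no length is lost when they are collected in the
  set \<open>principal_hooks p\<close>.\<close>

lemma inj_on_diag_hook:
  assumes "is_partition p"
  shows "inj_on (\<lambda>i. hook p i i) {1..durfee p}"
proof (rule linorder_inj_onI)
  fix i j assume ij: "i < j" "i \<in> {1..durfee p}" "j \<in> {1..durfee p}"
  then have "part p j \<le> part p i" "part (conjugate p) j \<le> part (conjugate p) i"
    "j \<le> part p j" "j \<le> part (conjugate p) j"
    using assms by (auto simp: part_antimono part_conjugate_antimono le_part_self_iff
        le_part_conjugate_self_iff)
  then show "hook p i i \<noteq> hook p j j" using ij by (simp add: hook_def)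
qed auto

lemma principal_hooks_eq:
  assumes "is_partition p"
  shows "principal_hooks p = (\<lambda>i. hook p i i) ` {1..durfee p}"
  by (simp add: principal_hooks_def diag_eq[OF assms])

lemma card_principal_hooks:
  assumes "is_partition p"
  shows "card (principal_hooks p) = durfee p"
  using card_image[OF inj_on_diag_hook[OF assms]] by (simp add: principal_hooks_eq assms)

text \<open>Counting boxes is the additive use of \<open>boxes_by_principal_hooks\<close>; its
  multiplicative use is in \<open>prod_boxes\<close>.\<close>

lemma weight_eq_sum_principal_hooks:
  assumes "is_partition p"
  shows "weight p = \<Sum>(principal_hooks p)"
proof -
  have "weight p = (\<Sum>i\<in>{1..durfee p}. card {i..part p i} + card {i<..part (conjugate p) i})"
    using sum.boxes_by_principal_hooks[OF assms, of "\<lambda>_. 1 :: nat"]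
    by (simp add: weight_eq_card_boxes)
  also have "\<dots> = (\<Sum>i\<in>{1..durfee p}. hook p i i)"
  proof (rule sum.cong[OF refl])
    fix i assume "i \<in> {1..durfee p}"
    then have "i \<le> part p i" using assms by (simp add: le_part_self_iff)
    then show "card {i..part p i} + card {i<..part (conjugate p) i} = hook p i i"
      by (simp add: hook_def)
  qed
  finally show ?thesis
    unfolding principal_hooks_eq[OF assms] sum.reindex[OF inj_on_diag_hook[OF assms]]
    by (simp add: comp_def)
qed

text \<open>The untruncated hook formula at \<open>(i, j)\<close> is positive at a box and negative
  outside the diagram, so it never vanishes. This is what keeps certain values out of
  \<open>S\<close> below.\<close>

lemma part_plus_part_conjugate_neq:
  assumes "is_partition p" "1 \<le> i" "1 \<le> j"
  shows "part p i + part (conjugate p) j + 1 \<noteq> i + j"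
  using le_part_conjugate_iff[OF assms] by (cases "j \<le> part p i") auto

lemma odd_principal_hooks:
  assumes "self_conjugate p" "h \<in> principal_hooks p"
  shows "odd h"
  using assms by (auto simp: self_conjugate_def principal_hooks_def hook_def)

section \<open>Hook lengths of a doubled distinct partition\<close>

context
  fixes p :: "nat list" and a :: "nat \<Rightarrow> nat" and d :: nat and S :: "nat set"
  assumes part: "is_partition p"
    and d: "d = durfee p"
    and a_pos: "\<And>i. i \<in> {1..d} \<Longrightarrow> 1 \<le> a i"
    and a_less: "\<And>i k. i \<in> {1..d} \<Longrightarrow> k \<in> {1..d} \<Longrightarrow> i < k \<Longrightarrow> a k < a i"
    and row: "\<And>i. i \<in> {1..d} \<Longrightarrow> part p i = i + a i"
    and col: "\<And>i. i \<in> {1..d} \<Longrightarrow> part (conjugate p) i + 1 = i + a i"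
    and S: "S = a ` {1..d}"
begin

lemma inj_on_a: "inj_on a {1..d}"
  by (rule linorder_inj_onI) (use a_less in fastforce)+

lemma inj_on_a_above: "inj_on a {i<..d}"
  by (rule inj_on_subset[OF inj_on_a]) auto

lemma a_less_iff:
  assumes "i \<in> {1..d}" "k \<in> {1..d}"
  shows "a k < a i \<longleftrightarrow> i < k"
  using a_less[of i k] a_less[of k i] assms by (cases i k rule: linorder_cases) auto

lemma S_below:
  assumes "i \<in> {1..d}"
  shows "S \<inter> {1..<a i} = a ` {i<..d}"
  using a_less_iff[OF assms] a_pos assms unfolding S by fastforce

text \<open>Exactly \<open>d - i\<close> of the \<open>a i - 1\<close> numbers in
  \<open>{1..<a i}\<close> lie in \<open>S\<close>. The remaining count is matched with the boxes
  outside the Durfee square, so that injectivity alone will give the bijections below.\<close>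

lemma card_not_S_below:
  assumes i: "i \<in> {1..d}"
  shows "card ({1..<a i} - S) + 1 = part p i - d" and "d < part p i"
    and "card ({1..<a i} - S) = part (conjugate p) i - d"
proof -
  have "card (a ` {i<..d}) = d - i"
    by (simp add: card_image inj_on_a_above)
  then have "card ({1..<a i} - S) = a i - 1 - (d - i)" and "d - i \<le> a i - 1"
    using S_below[OF i] card_Diff_subset_Int[of "{1..<a i}" S]
      card_mono[of "{1..<a i}" "S \<inter> {1..<a i}"] by (auto simp: Int_commute)
  then show "card ({1..<a i} - S) + 1 = part p i - d" and "d < part p i"
    and "card ({1..<a i} - S) = part (conjugate p) i - d"
    using a_pos[OF i] row[OF i] col[OF i] i by auto
qed

lemma part_le: "d < r \<Longrightarrow> part p r \<le> d"
  using part_antimono[OF part, of "d + 1" r] le_part_self_iff[OF part, of "d + 1"] d by auto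

lemma part_conjugate_le: "d < c \<Longrightarrow> part (conjugate p) c \<le> d"
  using part_conjugate_antimono[OF part, of "d + 1" c]
    le_part_conjugate_self_iff[OF part, of "d + 1"] d by auto

text \<open>The map sends \<open>c\<close> to \<open>a i\<close> minus the hook length at
  \<open>(i, c)\<close> and is strictly increasing. If it took the value \<open>a k\<close>, the
  hook formula at \<open>(k, c)\<close> would vanish. Equal cardinalities then give
  surjectivity.\<close>

lemma bij_betw_row:
  assumes i: "i \<in> {1..d}"
  shows "bij_betw (\<lambda>c. c - (part (conjugate p) c + 1)) {d<..part p i} ({..<a i} - S)"
proof -
  let ?g = "\<lambda>c. c - (part (conjugate p) c + 1)"
  have inj: "inj_on ?g {d<..part p i}"
  proof (rule linorder_inj_onI)
    fix x y assume xy: "x < y" "x \<in> {d<..part p i}" "y \<in> {d<..part p i}"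
    then show "?g x \<noteq> ?g y"
      using part_conjugate_antimono[OF part, of x y] part_conjugate_le[of x]
        part_conjugate_le[of y] by auto
  qed auto
  have "?g c \<in> {..<a i} - S" if c: "c \<in> {d<..part p i}" for c
  proof -
    have "i \<le> part (conjugate p) c" using le_part_conjugate_iff[OF part, of i c] i c by auto
    moreover have "?g c \<noteq> a k" if "k \<in> {1..d}" for k
      using part_plus_part_conjugate_neq[OF part, of k c] row[OF that] that c
        part_conjugate_le[of c] by auto
    moreover have "?g c < a i" using calculation(1) row[OF i] c a_pos[OF i] by auto
    ultimately show ?thesis unfolding S by blast
  qed
  moreover have "card ({..<a i} - S) = card {d<..part p i}"
  proof -
    have "{..<a i} - S = insert 0 ({1..<a i} - S)"
      using a_pos i unfolding S by fastforce
    then show ?thesis using card_not_S_below[OF i] by simp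
  qed
  ultimately have "?g ` {d<..part p i} = {..<a i} - S"
    using card_image[OF inj] by (intro card_subset_eq) auto
  then show ?thesis using inj by (simp add: bij_betw_def)
qed

text \<open>Again \<open>r\<close> goes to \<open>a i\<close> minus the hook length at
  \<open>(r, i)\<close>. The value 0 is missed because \<open>part p r \<le> d < r\<close>.\<close>

lemma bij_betw_col:
  assumes i: "i \<in> {1..d}"
  shows "bij_betw (\<lambda>r. r - part p r) {d<..part (conjugate p) i} ({1..<a i} - S)"
proof -
  let ?g = "\<lambda>r. r - part p r"
  have inj: "inj_on ?g {d<..part (conjugate p) i}"
  proof (rule linorder_inj_onI)
    fix x y assume xy: "x < y" "x \<in> {d<..part (conjugate p) i}"
      "y \<in> {d<..part (conjugate p) i}"
    then show "?g x \<noteq> ?g y"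
      using part_antimono[OF part, of x y] part_le[of x] part_le[of y] by auto
  qed auto
  have "?g r \<in> {1..<a i} - S" if r: "r \<in> {d<..part (conjugate p) i}" for r
  proof -
    have "i \<le> part p r" using le_part_conjugate_iff[OF part, of r i] i r by auto
    moreover have "?g r \<noteq> a k" if "k \<in> {1..d}" for k
      using part_plus_part_conjugate_neq[OF part, of r k] col[OF that] that r
        part_le[of r] by auto
    moreover have "?g r \<in> {1..<a i}"
      using calculation(1) col[OF i] r a_pos[OF i] part_le[of r] by auto
    ultimately show ?thesis unfolding S by blast
  qed
  moreover have "card ({1..<a i} - S) = card {d<..part (conjugate p) i}"
    using card_not_S_below[OF i] by simp
  ultimately have "?g ` {d<..part (conjugate p) i} = {1..<a i} - S"
    using card_image[OF inj] by (intro card_subset_eq) auto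
  then show ?thesis using inj by (simp add: bij_betw_def)
qed

lemma hook_square:
  assumes "i \<in> {1..d}" "k \<in> {1..d}"
  shows "hook p i k = a i + a k"
proof -
  \<comment> \<open>These bounds keep both subtractions in \<open>hook\<close> from
    truncating.\<close>
  have "d < part p i" "d \<le> part (conjugate p) k"
    using card_not_S_below[OF assms(1)]
      part_conjugate_antimono[OF part, of k d] le_part_conjugate_self_iff[OF part, of d] assms d
    by auto
  then show ?thesis using row[OF assms(1)] col[OF assms(2)] assms by (auto simp: hook_def)
qed

section \<open>Products over one principal hook and over all boxes\<close>

lemma prod_row_right:
  fixes z :: complex
  assumes i: "i \<in> {1..d}"
  shows "(\<Prod>c\<in>{d<..part p i}. 1 - z / of_nat (hook p i c)) =
    (1 - z / of_nat (a i)) * (\<Prod>j\<in>{1..<a i} - S. 1 - z / of_nat (a i - j))"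
proof -
  have "hook p i c = a i - (c - (part (conjugate p) c + 1))" if c: "c \<in> {d<..part p i}" for c
  proof -
    have "i \<le> part (conjugate p) c" using le_part_conjugate_iff[OF part, of i c] i c by auto
    then show ?thesis using row[OF i] c part_conjugate_le[of c] by (auto simp: hook_def)
  qed
  then have "(\<Prod>c\<in>{d<..part p i}. 1 - z / of_nat (hook p i c)) =
      (\<Prod>c\<in>{d<..part p i}. 1 - z / of_nat (a i - (c - (part (conjugate p) c + 1))))"
    by (intro prod.cong) auto
  also have "\<dots> = (\<Prod>j\<in>{..<a i} - S. 1 - z / of_nat (a i - j))"
    by (rule prod.reindex_bij_betw[OF bij_betw_row[OF i]])
  also have "{..<a i} - S = insert 0 ({1..<a i} - S)"
    using a_pos i unfolding S by fastforce
  finally show ?thesis by simp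
qed

lemma prod_col_below:
  fixes z :: complex
  assumes i: "i \<in> {1..d}"
  shows "(\<Prod>r\<in>{d<..part (conjugate p) i}. 1 + z / of_nat (hook p r i)) =
    (\<Prod>j\<in>{1..<a i} - S. 1 + z / of_nat (a i - j))"
proof -
  have "hook p r i = a i - (r - part p r)" if r: "r \<in> {d<..part (conjugate p) i}" for r
  proof -
    have "i \<le> part p r" using le_part_conjugate_iff[OF part, of r i] i r by auto
    then show ?thesis using col[OF i] r part_le[of r] by (auto simp: hook_def)
  qed
  then have "(\<Prod>r\<in>{d<..part (conjugate p) i}. 1 + z / of_nat (hook p r i)) =
      (\<Prod>r\<in>{d<..part (conjugate p) i}. 1 + z / of_nat (a i - (r - part p r)))"
    by (intro prod.cong) auto
  also have "\<dots> = (\<Prod>j\<in>{1..<a i} - S. 1 + z / of_nat (a i - j))"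
    by (rule prod.reindex_bij_betw[OF bij_betw_col[OF i]])
  finally show ?thesis .
qed

lemma prod_principal_hook:
  fixes z :: complex
  assumes i: "i \<in> {1..d}"
  shows "(\<Prod>c\<in>{i..part p i}. 1 - z / (of_nat (hook p i c) * box_sign i c)) *
      (\<Prod>r\<in>{i<..part (conjugate p) i}. 1 - z / (of_nat (hook p r i) * box_sign r i)) =
    (1 - z / of_nat (a i)) * (1 - z / of_nat (2 * a i)) *
      (\<Prod>j = 1..a i - 1. 1 - (z / (of_nat (a i) + tau S j * of_nat j)) ^ 2)"
proof -
  let ?N = "{1..<a i} - S"
  have fac: "1 - w ^ 2 = (1 - w) * (1 + w)" for w :: complex
    by (simp add: power2_eq_square algebra_simps)
  \<comment> \<open>Arm and leg are cut at the border of the Durfee square.\<close>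
  have split: "{i..part p i} = insert i ({i<..d} \<union> {d<..part p i})"
    "{i<..part (conjugate p) i} = {i<..d} \<union> {d<..part (conjugate p) i}"
    using card_not_S_below[OF i] i part_conjugate_antimono[OF part, of i d]
      le_part_conjugate_self_iff[OF part, of d] d by auto
  have "(\<Prod>c\<in>{i..part p i}. 1 - z / (of_nat (hook p i c) * box_sign i c)) =
      (\<Prod>c\<in>{i..part p i}. 1 - z / of_nat (hook p i c))"
    by (rule prod.cong) (auto simp: box_sign_def)
  also have "\<dots> = (1 - z / of_nat (hook p i i)) * ((\<Prod>k\<in>{i<..d}. 1 - z / of_nat (hook p i k)) *
      (\<Prod>c\<in>{d<..part p i}. 1 - z / of_nat (hook p i c)))"
    unfolding split using i by (subst prod.insert) (auto intro!: prod.union_disjoint)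
  also have "(\<Prod>k\<in>{i<..d}. 1 - z / of_nat (hook p i k)) =
      (\<Prod>k\<in>{i<..d}. 1 - z / of_nat (a i + a k))"
    using hook_square i by (intro prod.cong) auto
  finally have R: "(\<Prod>c\<in>{i..part p i}. 1 - z / (of_nat (hook p i c) * box_sign i c)) =
      (1 - z / of_nat (2 * a i)) * ((\<Prod>k\<in>{i<..d}. 1 - z / of_nat (a i + a k)) *
      ((1 - z / of_nat (a i)) * (\<Prod>j\<in>?N. 1 - z / of_nat (a i - j))))"
    unfolding prod_row_right[OF i] hook_square[OF i i] mult_2 .
  \<comment> \<open>Leg boxes lie strictly below the diagonal, so their sign -1 turns the minus into
    a plus.\<close>
  have "(\<Prod>r\<in>{i<..part (conjugate p) i}. 1 - z / (of_nat (hook p r i) * box_sign r i)) =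
      (\<Prod>r\<in>{i<..part (conjugate p) i}. 1 + z / of_nat (hook p r i))"
    by (rule prod.cong) (auto simp: box_sign_def)
  also have "\<dots> = (\<Prod>k\<in>{i<..d}. 1 + z / of_nat (hook p k i)) *
      (\<Prod>r\<in>{d<..part (conjugate p) i}. 1 + z / of_nat (hook p r i))"
    unfolding split by (rule prod.union_disjoint) auto
  also have "(\<Prod>k\<in>{i<..d}. 1 + z / of_nat (hook p k i)) =
      (\<Prod>k\<in>{i<..d}. 1 + z / of_nat (a i + a k))"
    using hook_square i by (intro prod.cong) (auto simp: add.commute)
  finally have C: "(\<Prod>r\<in>{i<..part (conjugate p) i}. 1 - z / (of_nat (hook p r i) * box_sign r i)) =
      (\<Prod>k\<in>{i<..d}. 1 + z / of_nat (a i + a k)) * (\<Prod>j\<in>?N. 1 + z / of_nat (a i - j))"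
    unfolding prod_col_below[OF i] .
  let ?h = "\<lambda>j. 1 - (z / (of_nat (a i) + tau S j * of_nat j)) ^ 2"
  \<comment> \<open>Membership in \<open>S\<close> decides \<open>tau\<close>:
    \<open>j = a k\<close> gives the denominator \<open>a i + a k\<close> of the Durfee square, any
    other \<open>j\<close> gives \<open>a i - j\<close> from outside it. Each difference of squares
    splits into an arm factor and a leg factor.\<close>
  have "{1..a i - 1} = (S \<inter> {1..<a i}) \<union> ?N" by auto
  then have "prod ?h {1..a i - 1} = prod ?h (S \<inter> {1..<a i}) * prod ?h ?N"
    by (simp only:) (rule prod.union_disjoint, auto)
  also have "prod ?h (S \<inter> {1..<a i}) = (\<Prod>k\<in>{i<..d}. ?h (a k))"
    unfolding S_below[OF i] by (simp add: prod.reindex inj_on_a_above)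
  also have "\<dots> = (\<Prod>k\<in>{i<..d}. (1 - z / of_nat (a i + a k)) * (1 + z / of_nat (a i + a k)))"
    using i by (intro prod.cong) (auto simp: tau_def S fac)
  also have "prod ?h ?N = (\<Prod>j\<in>?N. (1 - z / of_nat (a i - j)) * (1 + z / of_nat (a i - j)))"
    by (intro prod.cong) (auto simp: tau_def fac of_nat_diff)
  finally show ?thesis unfolding R C prod.distrib by (simp only: mult_ac)
qed

lemma prod_boxes:
  fixes z :: complex
  shows "(\<Prod>(i, j)\<in>boxes p. 1 - z / (of_nat (hook p i j) * box_sign i j)) =
    (\<Prod>h\<in>S. (1 - z / of_nat h) * (1 - z / of_nat (2 * h)) *
      (\<Prod>j = 1..h - 1. 1 - (z / (of_nat h + tau S j * of_nat j)) ^ 2))"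
  unfolding prod.boxes_by_principal_hooks[OF part] d[symmetric] S prod.reindex[OF inj_on_a] comp_def
  unfolding S[symmetric] using prod_principal_hook by (intro prod.cong) auto

end

section \<open>Assembling the theorem\<close>

lemma doubled_distinctE:
  assumes "doubled_distinct p"
  obtains a where "\<And>i. i \<in> {1..durfee p} \<Longrightarrow> 1 \<le> a i"
    and "\<And>i k. i \<in> {1..durfee p} \<Longrightarrow> k \<in> {1..durfee p} \<Longrightarrow> i < k \<Longrightarrow> a k < a i"
    and "\<And>i. i \<in> {1..durfee p} \<Longrightarrow> part p i = i + a i"
    and "\<And>i. i \<in> {1..durfee p} \<Longrightarrow> part (conjugate p) i + 1 = i + a i"
    and "principal_hooks p = (\<lambda>h. 2 * h) ` (a ` {1..durfee p})"
proof -
  have part: "is_partition p" using assms by (simp add: doubled_distinct_def)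
  \<comment> \<open>For the empty partition the conditions on \<open>a\<close> are vacuous, so both
    cases of the definition supply a witness.\<close>
  have "durfee [] = 0" by (simp add: durfee_def diag_def)
  then obtain a where a: "\<forall>i\<in>{1..durfee p}. 1 \<le> a i"
    "\<forall>i\<in>{1..durfee p}. \<forall>k\<in>{1..durfee p}. i < k \<longrightarrow> a k < a i"
    "\<forall>i\<in>{1..durfee p}. int (part p i) - int i = int (a i) \<and>
            int (part (conjugate p) i) - int i = int (a i) - 1"
    using assms unfolding doubled_distinct_def by (metis atLeastatMost_empty empty_iff zero_less_one)
  have row: "part p i = i + a i" and col: "part (conjugate p) i + 1 = i + a i"
    if "i \<in> {1..durfee p}" for i
    using bspec[OF a(3) that] by linarith+
  have "hook p i i = 2 * a i" if "i \<in> {1..durfee p}" for i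
  proof -
    have "1 \<le> a i" using a(1) that by auto
    then show ?thesis using row[OF that] col[OF that] by (auto simp: hook_def)
  qed
  then have "principal_hooks p = (\<lambda>h. 2 * h) ` (a ` {1..durfee p})"
    unfolding principal_hooks_eq[OF part] image_image by (intro image_cong) auto
  then show thesis using that a row col by blast
qed

theorem theorem3p10:
  fixes la mu nu :: "nat list" and S :: "nat set"
  assumes "self_conjugate la"
    and "doubled_distinct mu"
    and "S = principal_hooks la \<union> principal_hooks mu"
    and "doubled_distinct nu"
    and "principal_hooks nu = (\<lambda>h. 2 * h) ` S"
  shows "real (weight la) + real (weight mu) = real (weight nu) / 2 \<and>
    delta la * delta mu = delta nu \<and>
    (\<forall>t :: complex.
      (\<Prod>h\<in>S. (1 - (2 * t + 2) / of_nat h) * (1 - (t + 1) / of_nat h) *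
         (\<Prod>j = 1..h - 1. 1 - ((2 * t + 2) / (of_nat h + tau S j * of_nat j)) ^ 2))
      = (\<Prod>(i, j)\<in>boxes nu. 1 - (2 * t + 2) / (of_nat (hook nu i j) * box_sign i j)))"
proof (intro conjI allI)
  have la: "is_partition la" and mu: "is_partition mu" and nu: "is_partition nu"
    using assms by (auto simp: self_conjugate_def doubled_distinct_def)
  have fin: "finite (principal_hooks la)" "finite (principal_hooks mu)"
    by (simp_all add: principal_hooks_eq la mu)
  \<comment> \<open>Parity separates the two sets of principal hooks, so sums and cardinalities over
    \<open>S\<close> add up.\<close>
  have "even h" if "h \<in> principal_hooks mu" for h
    using doubled_distinctE[OF assms(2)] that by (metis (no_types, lifting) dvd_triv_left image_iff)
  then have disj: "principal_hooks la \<inter> principal_hooks mu = {}"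
    using odd_principal_hooks[OF assms(1)] by auto
  have inj2: "inj_on (\<lambda>h. 2 * h) A" for A :: "nat set" by (simp add: inj_on_def)
  have "weight nu = 2 * \<Sum>S"
    using assms(5) weight_eq_sum_principal_hooks[OF nu]
    by (simp add: sum.reindex inj2 sum_distrib_left)
  moreover have "\<Sum>S = weight la + weight mu"
    unfolding assms(3) using sum.union_disjoint[OF fin disj, of "\<lambda>x. x"]
    by (simp add: weight_eq_sum_principal_hooks la mu)
  ultimately show "real (weight la) + real (weight mu) = real (weight nu) / 2" by simp
  have "durfee nu = card S"
    using card_principal_hooks[OF nu] assms(5) by (simp add: card_image inj2)
  also have "\<dots> = durfee la + durfee mu"
    unfolding assms(3) using card_Un_disjoint[OF fin disj] by (simp add: card_principal_hooks la mu)
  finally show "delta la * delta mu = delta nu" by (simp add: delta_def power_add)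
  fix t :: complex
  obtain a where a: "\<And>i. i \<in> {1..durfee nu} \<Longrightarrow> 1 \<le> a i"
    "\<And>i k. i \<in> {1..durfee nu} \<Longrightarrow> k \<in> {1..durfee nu} \<Longrightarrow> i < k \<Longrightarrow> a k < a i"
    "\<And>i. i \<in> {1..durfee nu} \<Longrightarrow> part nu i = i + a i"
    "\<And>i. i \<in> {1..durfee nu} \<Longrightarrow> part (conjugate nu) i + 1 = i + a i"
    "principal_hooks nu = (\<lambda>h. 2 * h) ` (a ` {1..durfee nu})"
    using doubled_distinctE[OF assms(4)] by metis
  \<comment> \<open>Doubling is injective, so equal doubled sets have equal halves.\<close>
  have S: "S = a ` {1..durfee nu}"
    using a(5) assms(5) inj_image_eq_iff[OF inj2] by metis
  \<comment> \<open>With \<open>z = 2 * t + 2\<close> this turns the factor of the diagonal box into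
    the second linear factor; at \<open>h = 0\<close> both quotients are 0.\<close>
  have "(2 * t + 2) / of_nat (2 * h) = (t + 1) / of_nat h" for h
    by (cases "h = 0") (simp_all add: field_simps)
  then show "(\<Prod>h\<in>S. (1 - (2 * t + 2) / of_nat h) * (1 - (t + 1) / of_nat h) *
         (\<Prod>j = 1..h - 1. 1 - ((2 * t + 2) / (of_nat h + tau S j * of_nat j)) ^ 2))
      = (\<Prod>(i, j)\<in>boxes nu. 1 - (2 * t + 2) / (of_nat (hook nu i j) * box_sign i j))"
    using prod_boxes[OF nu refl a(1-4) S, of "2 * t + 2"] by simp
qed

end
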